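(* Let $p$ and $q$ be two distinct prime numbers and let $\alpha\geqslant\beta$ be two positive integers. Let $f(x)=x^\alpha(x+1)^\beta$. Then $\psi(p^\alpha q^\beta)=\dfrac{2^\alpha f^{(\alpha)}(1)}{\alpha!}$, where $f^{(\alpha)}$ denotes the $\alpha$-th derivative of $f$.
   Context: The function $\psi$ on positive integers is defined as follows: $\psi(n)$ is the number of non-empty chains, in the set of positive divisors of $n$ ordered by divisibility, whose largest element is $n$ (including the singleton chain $\{n\}$). Equivalently, $\psi(1)=1$ and $\psi(n)=1+\sum_{d\mid n,\,d\neq n}\psi(d)$. *)

theory Defs
  imports "HOL-Analysis.Analysis" "HOL-Computational_Algebra.Primes"
begin

(* The condition n \<in> C makes every counted chain non-empty, and together with
   \<forall>d\<in>C. d dvd n it says that n is the largest element of C; the latter also forces C to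
   consist of divisors of n. For n = 0 the value is meaningless. *)
definition psi :: "nat \<Rightarrow> nat" where
  "psi n = card {C. Complete_Partial_Order.chain (dvd) C \<and> n \<in> C \<and> (\<forall>d\<in>C. d dvd n)}"

end

theory Submission
  imports Defs "HOL-Computational_Algebra.Polynomial"
begin

text \<open>
  Both sides equal the sum of \<open>(\<alpha> choose j) (\<beta> choose j) 2 ^ (\<alpha> + \<beta> - j)\<close> over \<open>j\<close>.

  Deleting the top element of a chain gives either the empty set or a chain with a smaller
  top, so \<open>2 * psi n = 1 + (\<Sum>d | d dvd n. psi d)\<close> (\<open>two_psi_eq_sum_divisors\<close>). The divisors
  of \<open>p ^ a * q ^ b\<close> form a grid indexed by the exponents, so \<open>g a b = psi (p ^ a * q ^ b)\<close>
  satisfies \<open>2 * g a b = 1 + (\<Sum>i\<le>a. \<Sum>j\<le>b. g i j)\<close>. Taking the mixed difference of this in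
  both variables leaves a local recurrence,
  \<open>g (a+1) (b+1) = 2 g a (b+1) + 2 g (a+1) b - 2 g a b\<close>, with powers of two on the axes;
  the binomial sum obeys the same recurrence by Pascal's rule.

  On the analytic side, the derivative of order \<open>\<alpha>\<close> at 1 divided by \<open>\<alpha>!\<close> is the Taylor
  coefficient, that is, the coefficient of \<open>h ^ \<alpha>\<close> in \<open>f (1 + h) = (1 + h) ^ \<alpha> * (2 + h) ^ \<beta>\<close>.
  The binomial theorem turns it into the same sum divided by \<open>2 ^ \<alpha>\<close>.
\<close>

section \<open>Chains of divisors and their top elements\<close>

definition divisor_chains :: "nat \<Rightarrow> nat set set" where
  "divisor_chains n = {C. Complete_Partial_Order.chain (dvd) C \<and> n \<in> C \<and> (\<forall>d\<in>C. d dvd n)}"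

lemma psi_eq_card_divisor_chains: "psi n = card (divisor_chains n)"
  by (simp add: psi_def divisor_chains_def)

lemma divisor_chains_subset: "divisor_chains n \<subseteq> Pow {d. d dvd n}"
  by (auto simp: divisor_chains_def)

lemma finite_divisor_chains: "n > 0 \<Longrightarrow> finite (divisor_chains n)"
  by (rule finite_subset[OF divisor_chains_subset]) simp

lemma divisor_chains_disjoint: "m \<noteq> n \<Longrightarrow> divisor_chains m \<inter> divisor_chains n = {}"
  unfolding divisor_chains_def by (blast dest: dvd_antisym)

text \<open>
  In a finite non-empty chain of positive numbers the numerically largest element is a
  multiple of all others, since divisibility and \<open>\<le>\<close> agree on it.
\<close>

lemma dvd_chain_top_exists:
  fixes C :: "nat set"
  assumes "finite C" "C \<noteq> {}" "0 \<notin> C" "Complete_Partial_Order.chain (dvd) C"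
  obtains m where "m \<in> C" "\<And>d. d \<in> C \<Longrightarrow> d dvd m"
proof
  show "Max C \<in> C"
    using assms by simp
  show "d dvd Max C" if "d \<in> C" for d
  proof -
    have "d dvd Max C \<or> Max C dvd d"
      using assms(4) that \<open>Max C \<in> C\<close> by (rule chainD)
    moreover have "d \<le> Max C" "d > 0"
      using assms that by (auto intro: gr0I)
    ultimately show ?thesis
      by (auto dest: dvd_imp_le)
  qed
qed

lemma divisor_chains_eq:
  assumes "n > 0"
  shows "divisor_chains n =
    insert {n} (insert n ` (\<Union>d\<in>{d. d dvd n \<and> d \<noteq> n}. divisor_chains d))" (is "?L = ?R")
proof
  show "?L \<subseteq> ?R"
  proof
    fix C assume C: "C \<in> ?L"
    then have dvd: "d dvd n" if "d \<in> C" for d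
      using that by (auto simp: divisor_chains_def)
    have n: "insert n (C - {n}) = C"
      using C by (auto simp: divisor_chains_def)
    show "C \<in> ?R"
    proof (cases "C - {n} = {}")
      case True
      with n show ?thesis by auto
    next
      case False
      have chain: "Complete_Partial_Order.chain (dvd) (C - {n})"
        using C by (auto simp: divisor_chains_def intro: chain_subset)
      have "finite (C - {n})"
        using dvd assms by (auto intro: finite_subset[of _ "{d. d dvd n}"])
      moreover have "0 \<notin> C - {n}"
        using dvd assms by fastforce
      ultimately obtain m where m: "m \<in> C - {n}" "\<And>d. d \<in> C - {n} \<Longrightarrow> d dvd m"
        using False chain by (elim dvd_chain_top_exists) auto
      then have "C - {n} \<in> divisor_chains m"
        using chain by (auto simp: divisor_chains_def)
      moreover have "m dvd n" "m \<noteq> n"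
        using m(1) dvd by auto
      ultimately show ?thesis
        using n by blast
    qed
  qed
  show "?R \<subseteq> ?L"
    by (auto simp: divisor_chains_def Complete_Partial_Order.chain_def intro: dvd_trans)
qed

text \<open>
  Removing \<open>n\<close> is a bijection from the chains with top \<open>n\<close> other than \<open>{n}\<close> onto the disjoint
  union of the chains with top \<open>d\<close>, for the proper divisors \<open>d\<close>.
  The summand for \<open>d = n\<close> contributes a second copy of \<open>psi n\<close>; keeping it makes the sum range
  over all divisors, which is a full grid for a product of two prime powers.
\<close>

lemma two_psi_eq_sum_divisors:
  assumes "n > 0"
  shows "2 * psi n = 1 + (\<Sum>d | d dvd n. psi d)"
proof -
  let ?D = "{d. d dvd n \<and> d \<noteq> n}"
  let ?U = "\<Union>d\<in>?D. divisor_chains d"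
  have pos: "d > 0" if "d \<in> ?D" for d
    using assms that by (auto intro: gr0I)
  have finD: "finite ?D"
    using assms by simp
  have finU: "finite ?U"
    using finD pos by (auto intro!: finite_divisor_chains)
  have notin: "n \<notin> C" if "C \<in> ?U" for C
    using that unfolding divisor_chains_def by (blast dest: dvd_antisym)
  have "inj_on (insert n) ?U"
    by (rule inj_onI) (metis notin insert_ident)
  then have "card (insert n ` ?U) = card ?U"
    by (rule card_image)
  also have "\<dots> = (\<Sum>d\<in>?D. psi d)"
    unfolding psi_eq_card_divisor_chains
    using finD pos divisor_chains_disjoint
    by (intro card_UN_disjoint) (auto intro!: finite_divisor_chains)
  finally have card: "card (insert n ` ?U) = (\<Sum>d\<in>?D. psi d)" .
  have "{n} \<notin> insert n ` ?U"
  proof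
    assume "{n} \<in> insert n ` ?U"
    then obtain C d where "C \<in> ?U" "{n} = insert n C" "d \<in> C"
      by (auto simp: divisor_chains_def)
    with notin show False by blast
  qed
  with finU card have psi: "psi n = 1 + (\<Sum>d\<in>?D. psi d)"
    by (simp add: psi_eq_card_divisor_chains divisor_chains_eq[OF assms])
  have "{d. d dvd n} = insert n ?D"
    by auto
  with psi finD show ?thesis
    by simp
qed

section \<open>Two prime powers: the grid of exponents\<close>

lemma bij_betw_exponents_divisors:
  fixes p q :: nat
  assumes p: "prime p" and q: "prime q" and "p \<noteq> q"
  shows "bij_betw (\<lambda>(i, j). p ^ i * q ^ j) ({..a} \<times> {..b}) {d. d dvd p ^ a * q ^ b}"
proof (rule bij_betw_imageI)
  have mult: "multiplicity p (p ^ i * q ^ j) = i" "multiplicity q (p ^ i * q ^ j) = j" for i j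
    using assms by (simp_all add: prime_elem_multiplicity_mult_distrib multiplicity_distinct_prime_power)
  show "inj_on (\<lambda>(i, j). p ^ i * q ^ j) ({..a} \<times> {..b})"
    by (rule inj_onI) (use mult in \<open>auto, metis+\<close>)
  show "(\<lambda>(i, j). p ^ i * q ^ j) ` ({..a} \<times> {..b}) = {d. d dvd p ^ a * q ^ b}"
  proof (intro equalityI subsetI)
    fix d assume "d \<in> {d. d dvd p ^ a * q ^ b}"
    then obtain x y where "d = x * y" "x dvd p ^ a" "y dvd q ^ b"
      using division_decomp by blast
    then show "d \<in> (\<lambda>(i, j). p ^ i * q ^ j) ` ({..a} \<times> {..b})"
      using divides_primepow_nat[OF p] divides_primepow_nat[OF q] by auto
  qed (auto intro!: mult_dvd_mono le_imp_power_dvd)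
qed

lemma two_psi_prime_powers:
  fixes p q :: nat
  assumes "prime p" "prime q" "p \<noteq> q"
  shows "2 * psi (p ^ a * q ^ b) = 1 + (\<Sum>i\<le>a. \<Sum>j\<le>b. psi (p ^ i * q ^ j))"
proof -
  have "(\<Sum>i\<le>a. \<Sum>j\<le>b. psi (p ^ i * q ^ j)) =
      (\<Sum>z\<in>{..a} \<times> {..b}. psi ((\<lambda>(i, j). p ^ i * q ^ j) z))"
    by (simp add: sum.cartesian_product case_prod_unfold)
  also have "\<dots> = (\<Sum>d | d dvd p ^ a * q ^ b. psi d)"
    by (rule sum.reindex_bij_betw[OF bij_betw_exponents_divisors[OF assms]])
  finally show ?thesis
    using assms by (simp add: two_psi_eq_sum_divisors prime_gt_0_nat)
qed

section \<open>The recurrence and its closed form\<close>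

definition chain_sum :: "nat \<Rightarrow> nat \<Rightarrow> real" where
  "chain_sum a b = (\<Sum>j\<le>a. real (a choose j) * real (b choose j) * (2 ^ (a + b) / 2 ^ j))"

lemma chain_sum_0_right: "chain_sum a 0 = 2 ^ a"
proof -
  have "chain_sum a 0 = (\<Sum>j\<in>{0}. real (a choose j) * real (0 choose j) * (2 ^ (a + 0) / 2 ^ j))"
    unfolding chain_sum_def by (rule sum.mono_neutral_right) auto
  then show ?thesis by simp
qed

lemma chain_sum_0_left: "chain_sum 0 b = 2 ^ b"
  by (simp add: chain_sum_def)

text \<open>
  By Pascal's rule the mixed difference of \<open>(a choose j) (b choose j)\<close> is
  \<open>(a choose (j - 1)) (b choose (j - 1))\<close>. Weighting by the powers of two makes the contribution
  of each \<open>j\<close> to the recurrence a difference of consecutive terms, and the sum telescopes.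
\<close>

lemma chain_sum_Suc_Suc:
  "chain_sum (Suc a) (Suc b) =
     2 * chain_sum a (Suc b) + 2 * chain_sum (Suc a) b - 2 * chain_sum a b"
proof -
  define T where "T a b j = real (a choose j) * real (b choose j) * (2 ^ (a + b) / 2 ^ j)" for a b j
  have ext: "chain_sum a c = (\<Sum>j\<le>Suc a. T a c j)" for c
    by (simp add: chain_sum_def T_def)
  have ext': "chain_sum (Suc a) c = (\<Sum>j\<le>Suc a. T (Suc a) c j)" for c
    unfolding chain_sum_def T_def ..
  \<comment> \<open>\<open>U j\<close> is \<open>2 * T a b (j - 1)\<close>, with the value 0 at \<open>j = 0\<close>\<close>
  define U where "U j = (case j of 0 \<Rightarrow> 0 | Suc i \<Rightarrow> 2 * T a b i)" for j
  have step: "T (Suc a) (Suc b) j - 2 * T a (Suc b) j - 2 * T (Suc a) b j + 2 * T a b j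
      = U j - U (Suc j)" for j
  proof (cases j)
    case (Suc i)
    have "2 ^ Suc i = 2 * (2 ^ i :: real)"
      by simp
    then show ?thesis
      unfolding Suc T_def U_def nat.case binomial_Suc_Suc of_nat_add
      by (simp add: power_add algebra_simps)
  qed (simp add: T_def U_def power_add)
  have "chain_sum (Suc a) (Suc b) - 2 * chain_sum a (Suc b) - 2 * chain_sum (Suc a) b
      + 2 * chain_sum a b = (\<Sum>j\<le>Suc a. U j - U (Suc j))"
    unfolding ext ext' step[symmetric]
    by (simp only: sum.distrib sum_subtractf sum_distrib_left)
  also have "\<dots> = U 0 - U (Suc (Suc a))"
    by (rule sum_telescope)
  also have "\<dots> = 0"
    by (simp add: U_def T_def)
  finally show ?thesis
    by simp
qed

text \<open>
  Inclusion and exclusion of rectangles turns the hypothesis into the local recurrence: in the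
  alternating sum over the corners of a unit square everything cancels except the value of \<open>g\<close> at
  the far corner.
\<close>

lemma grid_recurrence_unique:
  fixes g :: "nat \<Rightarrow> nat \<Rightarrow> real"
  assumes g: "\<And>a b. 2 * g a b = 1 + (\<Sum>i\<le>a. \<Sum>j\<le>b. g i j)"
  shows "g a b = chain_sum a b"
proof -
  have g00: "g 0 0 = 1"
    using g[of 0 0] by simp
  have right: "g 0 (Suc b) = 2 * g 0 b" for b
    using g[of 0 "Suc b"] g[of 0 b] by simp
  have up: "g (Suc a) 0 = 2 * g a 0" for a
    using g[of "Suc a" 0] g[of a 0] by simp
  have diag: "g (Suc a) (Suc b) = 2 * g a (Suc b) + 2 * g (Suc a) b - 2 * g a b" for a b
    using g[of "Suc a" "Suc b"] g[of a "Suc b"] g[of "Suc a" b] g[of a b]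
    by (simp add: sum.distrib)
  have g0: "g 0 b = 2 ^ b" for b
    by (induction b) (simp_all add: g00 right)
  show ?thesis
  proof (induction a arbitrary: b)
    case 0
    show ?case by (simp add: g0 chain_sum_0_left)
  next
    case (Suc a)
    show ?case
    proof (induction b)
      case 0
      show ?case by (simp add: up Suc.IH chain_sum_0_right)
    next
      case (Suc b)
      then show ?case by (simp add: diag chain_sum_Suc_Suc \<open>\<And>b. g a b = chain_sum a b\<close>)
    qed
  qed
qed

lemma psi_prime_powers_eq_chain_sum:
  fixes p q :: nat
  assumes "prime p" "prime q" "p \<noteq> q"
  shows "real (psi (p ^ a * q ^ b)) = chain_sum a b"
proof (rule grid_recurrence_unique)
  fix a b
  show "2 * real (psi (p ^ a * q ^ b)) = 1 + (\<Sum>i\<le>a. \<Sum>j\<le>b. real (psi (p ^ i * q ^ j)))"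
    using arg_cong[OF two_psi_prime_powers[OF assms, of a b], of real] by simp
qed

section \<open>Higher derivatives as Taylor coefficients\<close>

lemma higher_deriv_poly_shift:
  fixes P :: "real poly"
  shows "(deriv ^^ m) (\<lambda>x. poly P (x - c)) = (\<lambda>x. poly ((pderiv ^^ m) P) (x - c))"
proof (induction m)
  case (Suc m)
  have "deriv (\<lambda>x. poly Q (x - c)) = (\<lambda>x. poly (pderiv Q) (x - c))" for Q :: "real poly"
  proof
    fix x
    have "((\<lambda>x. poly Q (x - c)) has_field_derivative poly (pderiv Q) (x - c) * 1) (at x)"
      by (rule DERIV_chain2[OF poly_DERIV]) (auto intro!: derivative_eq_intros)
    then show "deriv (\<lambda>x. poly Q (x - c)) x = poly (pderiv Q) (x - c)"
      by (simp add: DERIV_imp_deriv)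
  qed
  with Suc show ?case by simp
qed simp

lemma higher_deriv_poly_shift_center:
  fixes P :: "real poly"
  shows "(deriv ^^ m) (\<lambda>x. poly P (x - c)) c = fact m * coeff P m"
  using coeff_higher_pderiv[of m P 0]
  by (simp add: higher_deriv_poly_shift poly_0_coeff_0 pochhammer_fact)

lemma coeff_linear_poly_power':
  fixes c d :: "'a :: comm_semiring_1"
  shows "coeff ([:c, d:] ^ n) i = of_nat (n choose i) * d ^ i * c ^ (n - i)"
proof (cases "i \<le> n")
  case False
  have "degree ([:c, d:] ^ n) \<le> n"
    using degree_power_le[of "[:c, d:]" n] by (simp split: if_splits)
  with False show ?thesis
    by (simp add: coeff_eq_0 binomial_eq_0)
qed (simp add: coeff_linear_poly_power)

text \<open>
  To reach \<open>h ^ a\<close> in \<open>(1 + h) ^ a * (2 + h) ^ b\<close>, take \<open>h ^ j\<close> from the second factor and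
  \<open>h ^ (a - j)\<close> from the first. The symmetry of binomial coefficients does the rest.
\<close>

lemma coeff_product_eq_chain_sum:
  "2 ^ a * coeff ([:1, 1:] ^ a * [:2, 1:] ^ b :: real poly) a = chain_sum a b"
proof -
  have "coeff ([:1, 1:] ^ a * [:2, 1:] ^ b :: real poly) a =
      coeff ([:2, 1:] ^ b * [:1, 1:] ^ a :: real poly) a"
    by (simp only: mult.commute)
  also have "\<dots> = (\<Sum>j\<le>a. real (b choose j) * 2 ^ (b - j) * real (a choose (a - j)))"
    by (simp add: coeff_mult coeff_linear_poly_power')
  finally have "2 ^ a * coeff ([:1, 1:] ^ a * [:2, 1:] ^ b :: real poly) a =
      (\<Sum>j\<le>a. 2 ^ a * (real (b choose j) * 2 ^ (b - j) * real (a choose (a - j))))"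
    by (simp add: sum_distrib_left)
  also have "\<dots> = chain_sum a b"
    unfolding chain_sum_def
  proof (rule sum.cong)
    fix j assume "j \<in> {..a}"
    then have "a choose (a - j) = a choose j"
      by (simp add: binomial_symmetric[symmetric])
    then show "2 ^ a * (real (b choose j) * 2 ^ (b - j) * real (a choose (a - j))) =
        real (a choose j) * real (b choose j) * (2 ^ (a + b) / 2 ^ j)"
      \<comment> \<open>for \<open>j > b\<close> the subtraction \<open>b - j\<close> truncates, but both sides vanish\<close>
      by (cases "j \<le> b") (simp_all add: power_add power_diff binomial_eq_0)
  qed simp
  finally show ?thesis .
qed

theorem theorem5p6:
  fixes p q \<alpha> \<beta> :: nat and f :: "real \<Rightarrow> real"
  assumes "prime p" and "prime q" and "p \<noteq> q"
    and "\<alpha> \<ge> \<beta>" and "\<alpha> > 0" and "\<beta> > 0"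
    and "f = (\<lambda>x. x ^ \<alpha> * (x + 1) ^ \<beta>)"
  shows "real (psi (p ^ \<alpha> * q ^ \<beta>)) = 2 ^ \<alpha> * (deriv ^^ \<alpha>) f 1 / fact \<alpha>"
proof -
  let ?P = "[:1, 1:] ^ \<alpha> * [:2, 1:] ^ \<beta> :: real poly"
  have "f = (\<lambda>x. poly ?P (x - 1))"
    by (simp add: assms(7) poly_power add.commute)
  then have "(deriv ^^ \<alpha>) f 1 = fact \<alpha> * coeff ?P \<alpha>"
    by (simp only: higher_deriv_poly_shift_center)
  then have "2 ^ \<alpha> * (deriv ^^ \<alpha>) f 1 / fact \<alpha> = chain_sum \<alpha> \<beta>"
    by (simp add: coeff_product_eq_chain_sum[symmetric])
  then show ?thesis
    using assms(1-3) by (simp add: psi_prime_powers_eq_chain_sum)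
qed

end
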